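(* For every job set $S$ in a three-machine permutation flowshop, a set of Pareto permutations $OptPerm(S)$ of $S$ can be computed as $$OptPerm(S)=MinPerm\big\{\,OptPerm_l(S\setminus\{k\}).k \;:\; k\in S,\ l\in\{1,\dots,|OptPerm(S\setminus\{k\})|\}\,\big\},$$ that is, applying $MinPerm$ to the set of all permutations obtained by appending a job $k\in S$ to a Pareto permutation of $S\setminus\{k\}$ yields a set of Pareto permutations of $S$.
   Context: Three-machine flowshop: each job $i$ has non-negative integer processing times $p_{i1},p_{i2},p_{i3}$ on machines 1, 2, 3, processed in that order; each machine processes one job at a time. A permutation $\pi$ is scheduled from time $0$ as a permutation schedule (same order on all machines, every operation as early as possible); $C^M_j(\pi)$ is the completion time of the last job of $\pi$ on machine $j$, and the criteria vector of $\pi$ is $\langle C^M_2(\pi),C^M_3(\pi)\rangle$. For a set of permutations of a job set, $MinPerm$ returns its Pareto permutations: those whose criteria vector is not dominated by that of another permutation of the set, keeping only one (arbitrary) permutation per criteria vector. $OptPerm(S)$ denotes the Pareto permutations of the set of all permutations of $S$, and $OptPerm_l(S)$ is its $l$-th element under an arbitrary numbering; $OptPerm(\{j\})=\{(j)\}$. For a permutation $\pi$ and a job $k$ not in $\pi$, $\pi.k$ is the permutation obtained by appending $k$ at the end. *)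

theory Defs
  imports Main "HOL-Combinatorics.Multiset_Permutations"
begin

text \<open>
  An instance is given by the processing times: \<open>p j m\<close> is the processing time of job \<open>j\<close> on
  machine \<open>m\<close>, for \<open>m \<in> {1, 2, 3}\<close>.  A permutation of a job set is a list (no repetition), as in
  \<^const>\<open>permutations_of_set\<close>.
\<close>

text \<open>
  \<open>completion p \<pi> i m\<close> is the completion time on machine \<open>m\<close> of the \<open>i\<close>-th job of \<open>\<pi>\<close>, where
  positions and machines are numbered from 1.  The operation starts as soon as machine \<open>m\<close> has
  finished the preceding job of \<open>\<pi>\<close> and the job itself has left machine \<open>m - 1\<close>.  Position 0 and
  machine 0 are fictitious: they say that machines and jobs are available from time 0.
\<close>

fun completion :: "('j \<Rightarrow> nat \<Rightarrow> nat) \<Rightarrow> 'j list \<Rightarrow> nat \<Rightarrow> nat \<Rightarrow> nat" where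
  "completion p \<pi> 0 m = 0"
| "completion p \<pi> (Suc i) 0 = 0"
| "completion p \<pi> (Suc i) (Suc m) =
     max (completion p \<pi> i (Suc m)) (completion p \<pi> (Suc i) m) + p (\<pi> ! i) (Suc m)"

definition CM :: "('j \<Rightarrow> nat \<Rightarrow> nat) \<Rightarrow> nat \<Rightarrow> 'j list \<Rightarrow> nat" where
  "CM p m \<pi> = completion p \<pi> (length \<pi>) m"

definition criteria :: "('j \<Rightarrow> nat \<Rightarrow> nat) \<Rightarrow> 'j list \<Rightarrow> nat \<times> nat" where
  "criteria p \<pi> = (CM p 2 \<pi>, CM p 3 \<pi>)"

definition dominates :: "nat \<times> nat \<Rightarrow> nat \<times> nat \<Rightarrow> bool" where
  "dominates u v \<longleftrightarrow> fst u \<le> fst v \<and> snd u \<le> snd v \<and> u \<noteq> v"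

definition nondominated :: "('j \<Rightarrow> nat \<Rightarrow> nat) \<Rightarrow> 'j list set \<Rightarrow> 'j list set" where
  "nondominated p P = {\<pi> \<in> P. \<not> (\<exists>\<sigma>\<in>P. dominates (criteria p \<sigma>) (criteria p \<pi>))}"

text \<open>
  The representative kept for each criteria vector is arbitrary, so the operators \<open>MinPerm\<close> and
  \<open>OptPerm\<close> are rendered as relations: \<open>is_MinPerm p P Q\<close> means that \<open>Q\<close> is a possible value of
  \<open>MinPerm P\<close>, and \<open>is_OptPerm p S Q\<close> that \<open>Q\<close> is a possible value of \<open>OptPerm S\<close>.
\<close>

definition is_MinPerm :: "('j \<Rightarrow> nat \<Rightarrow> nat) \<Rightarrow> 'j list set \<Rightarrow> 'j list set \<Rightarrow> bool" where
  "is_MinPerm p P Q \<longleftrightarrow>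
     Q \<subseteq> nondominated p P \<and>
     (\<forall>\<pi> \<in> nondominated p P. \<exists>!\<sigma>. \<sigma> \<in> Q \<and> criteria p \<sigma> = criteria p \<pi>)"

definition is_OptPerm :: "('j \<Rightarrow> nat \<Rightarrow> nat) \<Rightarrow> 'j set \<Rightarrow> 'j list set \<Rightarrow> bool" where
  "is_OptPerm p S Q \<longleftrightarrow> is_MinPerm p (permutations_of_set S) Q"

lemma is_OptPerm_singleton: "is_OptPerm p {j} Q \<longleftrightarrow> Q = {[j]}"
  by (auto simp: is_OptPerm_def is_MinPerm_def nondominated_def dominates_def)

lemma is_OptPerm_empty: "is_OptPerm p {} Q \<longleftrightarrow> Q = {[]}"
  by (auto simp: is_OptPerm_def is_MinPerm_def nondominated_def dominates_def)

end

theory Submission imports Defs begin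

text \<open>
  All permutations of a job set \<open>T\<close> finish machine 1 at the same time, the total processing time
  of \<open>T\<close> on machine 1.  Hence, for permutations of \<open>T\<close>, the criteria vector of \<open>\<pi>.k\<close> is a
  monotone function of that of \<open>\<pi>\<close>: replacing the prefix of a permutation of \<open>S\<close> by a Pareto
  permutation that weakly dominates it makes neither criterion worse, so every permutation of \<open>S\<close>
  is weakly dominated by a candidate.  A subset with this covering property has the same Pareto
  vectors as the whole set.
\<close>

text \<open>The recursion at position \<open>i\<close> reads only the first \<open>i\<close> jobs,
  so appended jobs cannot delay them.\<close>

lemma completion_append:
  "i \<le> length \<pi> \<Longrightarrow> completion p (\<pi> @ \<tau>) i m = completion p \<pi> i m"
  by (induction p \<pi> i m rule: completion.induct) (auto simp: nth_append)

lemma CM_0: "CM p 0 \<pi> = 0"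
  by (cases "length \<pi>") (simp_all add: CM_def)

lemma CM_Nil: "CM p m [] = 0"
  by (simp add: CM_def)

text \<open>In the \<open>max\<close>, the preceding position on the same machine lies within
  \<open>\<pi>\<close>, while the preceding machine still processes \<open>k\<close>.\<close>

lemma CM_snoc: "CM p (Suc m) (\<pi> @ [k]) = max (CM p (Suc m) \<pi>) (CM p m (\<pi> @ [k])) + p k (Suc m)"
  by (simp add: CM_def completion_append)

text \<open>The fictitious machine 0 releases every job at time 0, so machine 1 never idles.\<close>

lemma CM_1: "CM p 1 \<pi> = (\<Sum>j\<leftarrow>\<pi>. p j 1)"
  by (induction \<pi> rule: rev_induct) (simp_all add: CM_Nil CM_snoc CM_0)

lemma CM_1_permutations_of_set:
  "\<pi> \<in> permutations_of_set T \<Longrightarrow> CM p 1 \<pi> = (\<Sum>j\<in>T. p j 1)"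
  by (auto simp: CM_1 permutations_of_set_def sum_list_distinct_conv_sum_set simp del: One_nat_def)

text \<open>Reflexive closure of \<open>dominates\<close>. Covering needs equality, since only one
  permutation per criteria vector is kept.\<close>

definition weakly_dominates :: "nat \<times> nat \<Rightarrow> nat \<times> nat \<Rightarrow> bool" where
  "weakly_dominates u v \<longleftrightarrow> fst u \<le> fst v \<and> snd u \<le> snd v"

lemma weakly_dominates_refl: "weakly_dominates u u"
  by (simp add: weakly_dominates_def)

lemma weakly_dominates_trans:
  "weakly_dominates u v \<Longrightarrow> weakly_dominates v w \<Longrightarrow> weakly_dominates u w"
  by (auto simp: weakly_dominates_def)

lemma weakly_dominates_iff: "weakly_dominates u v \<longleftrightarrow> u = v \<or> dominates u v"
  by (auto simp: weakly_dominates_def dominates_def)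

lemma weakly_dominates_dominates_trans:
  "weakly_dominates u v \<Longrightarrow> dominates v w \<Longrightarrow> dominates u w"
  by (cases u; cases v; cases w) (auto simp: weakly_dominates_def dominates_def)

text \<open>\<open>max\<close> and \<open>+\<close> are monotone, and the only other input, the
  completion time on machine 1, is the same for both because they share the job set
  \<open>T\<close>.\<close>

lemma criteria_snoc_mono:
  assumes "\<pi> \<in> permutations_of_set T" "\<sigma> \<in> permutations_of_set T"
    and "weakly_dominates (criteria p \<sigma>) (criteria p \<pi>)"
  shows "weakly_dominates (criteria p (\<sigma> @ [k])) (criteria p (\<pi> @ [k]))"
proof -
  have "CM p 1 (\<sigma> @ [k]) = CM p 1 (\<pi> @ [k])"
    using CM_1_permutations_of_set[OF assms(1), of p] CM_1_permutations_of_set[OF assms(2), of p]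
    by (simp add: CM_1 del: One_nat_def)
  moreover have "CM p 2 \<sigma> \<le> CM p 2 \<pi>" "CM p 3 \<sigma> \<le> CM p 3 \<pi>"
    using assms(3) by (simp_all add: weakly_dominates_def criteria_def)
  moreover have "CM p 2 (\<tau> @ [k]) = max (CM p 2 \<tau>) (CM p 1 (\<tau> @ [k])) + p k 2"
    "CM p 3 (\<tau> @ [k]) = max (CM p 3 \<tau>) (CM p 2 (\<tau> @ [k])) + p k 3" for \<tau>
    using CM_snoc[of p 1 \<tau> k] CM_snoc[of p 2 \<tau> k] by (simp_all add: numeral_eq_Suc)
  ultimately show ?thesis
    by (auto simp: weakly_dominates_def criteria_def)
qed

text \<open>Descent: passing to a dominating vector strictly decreases the sum of the two criteria,
  a natural number.\<close>

lemma nondominated_cover: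
  assumes "\<pi> \<in> P"
  shows "\<exists>\<sigma>\<in>nondominated p P. weakly_dominates (criteria p \<sigma>) (criteria p \<pi>)"
  using assms
proof (induction "fst (criteria p \<pi>) + snd (criteria p \<pi>)" arbitrary: \<pi> rule: less_induct)
  case less
  show ?case
  proof (cases "\<pi> \<in> nondominated p P")
    case True
    then show ?thesis by (intro bexI[of _ \<pi>] weakly_dominates_refl)
  next
    case False
    then obtain \<tau> where \<tau>: "\<tau> \<in> P" "dominates (criteria p \<tau>) (criteria p \<pi>)"
      using less.prems by (auto simp: nondominated_def)
    then have "fst (criteria p \<tau>) + snd (criteria p \<tau>) < fst (criteria p \<pi>) + snd (criteria p \<pi>)"
      by (auto simp: dominates_def prod_eq_iff)
    from less.hyps[OF this \<tau>(1)] obtain \<sigma>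
      where \<sigma>: "\<sigma> \<in> nondominated p P" "weakly_dominates (criteria p \<sigma>) (criteria p \<tau>)"
      by blast
    have "weakly_dominates (criteria p \<tau>) (criteria p \<pi>)"
      using \<tau>(2) by (simp add: weakly_dominates_iff)
    then show ?thesis
      using \<sigma>(1) by (intro bexI[of _ \<sigma>] weakly_dominates_trans[OF \<sigma>(2)])
  qed
qed

lemma is_MinPerm_cover:
  assumes "is_MinPerm p P Q" "\<pi> \<in> P"
  shows "\<exists>\<sigma>\<in>Q. weakly_dominates (criteria p \<sigma>) (criteria p \<pi>)"
proof -
  obtain \<tau> where \<tau>: "\<tau> \<in> nondominated p P" "weakly_dominates (criteria p \<tau>) (criteria p \<pi>)"
    using nondominated_cover[OF assms(2), of p] by blast
  then have "\<exists>!\<sigma>. \<sigma> \<in> Q \<and> criteria p \<sigma> = criteria p \<tau>"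
    using assms(1) by (simp add: is_MinPerm_def)
  then obtain \<sigma> where "\<sigma> \<in> Q" "criteria p \<sigma> = criteria p \<tau>"
    by (elim ex1E conjE)
  with \<tau>(2) show ?thesis by (intro bexI[of _ \<sigma>]) simp_all
qed

text \<open>Ensures that a claim about all values of \<open>MinPerm\<close> is not vacuous.\<close>

lemma is_MinPerm_exists: "\<exists>Q. is_MinPerm p P Q"
proof -
  define N where "N = nondominated p P"
  \<comment> \<open>\<open>inv_into\<close> chooses one preimage in \<open>N\<close> for each
    attained criteria vector, so distinct elements of \<open>Q\<close> have distinct
    vectors.\<close>
  define Q where "Q = inv_into N (criteria p) ` criteria p ` N"
  have "Q \<subseteq> N"
    unfolding Q_def by (auto intro: inv_into_into)
  moreover have "\<exists>!\<sigma>. \<sigma> \<in> Q \<and> criteria p \<sigma> = criteria p \<pi>" if "\<pi> \<in> N" for \<pi>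
  proof (rule ex1I[of _ "inv_into N (criteria p) (criteria p \<pi>)"])
    show "inv_into N (criteria p) (criteria p \<pi>) \<in> Q \<and>
      criteria p (inv_into N (criteria p) (criteria p \<pi>)) = criteria p \<pi>"
      using that by (simp add: Q_def f_inv_into_f)
  next
    fix \<sigma> assume "\<sigma> \<in> Q \<and> criteria p \<sigma> = criteria p \<pi>"
    then show "\<sigma> = inv_into N (criteria p) (criteria p \<pi>)"
      by (auto simp: Q_def f_inv_into_f)
  qed
  ultimately have "is_MinPerm p P Q"
    by (simp add: is_MinPerm_def N_def)
  then show ?thesis ..
qed

lemma is_MinPerm_superset:
  assumes "C \<subseteq> P"
    and cover: "\<And>\<pi>. \<pi> \<in> P \<Longrightarrow> \<exists>\<sigma>\<in>C. weakly_dominates (criteria p \<sigma>) (criteria p \<pi>)"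
    and Q: "is_MinPerm p C Q"
  shows "is_MinPerm p P Q"
proof -
  \<comment> \<open>A dominator in \<open>P\<close> of an element of \<open>C\<close> is itself
    covered by some element of \<open>C\<close>, which would then be a dominator inside
    \<open>C\<close>.\<close>
  have sub: "nondominated p C \<subseteq> nondominated p P"
  proof
    fix \<pi> assume \<pi>: "\<pi> \<in> nondominated p C"
    have "\<not> dominates (criteria p \<sigma>) (criteria p \<pi>)" if "\<sigma> \<in> P" for \<sigma>
    proof
      assume dom: "dominates (criteria p \<sigma>) (criteria p \<pi>)"
      obtain \<tau> where \<tau>: "\<tau> \<in> C" "weakly_dominates (criteria p \<tau>) (criteria p \<sigma>)"
        using cover[OF \<open>\<sigma> \<in> P\<close>] by blast
      have "dominates (criteria p \<tau>) (criteria p \<pi>)"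
        using weakly_dominates_dominates_trans[OF \<tau>(2) dom] .
      with \<pi> \<tau>(1) show False by (auto simp: nondominated_def)
    qed
    with \<pi> assms(1) show "\<pi> \<in> nondominated p P" by (auto simp: nondominated_def)
  qed
  \<comment> \<open>The converse holds only up to criteria vectors: a Pareto permutation of
    \<open>P\<close> may lie outside \<open>C\<close>.\<close>
  have rep: "\<exists>\<sigma>\<in>nondominated p C. criteria p \<sigma> = criteria p \<pi>"
    if \<pi>: "\<pi> \<in> nondominated p P" for \<pi>
  proof -
    from \<pi> cover obtain \<sigma> where \<sigma>: "\<sigma> \<in> C" "weakly_dominates (criteria p \<sigma>) (criteria p \<pi>)"
      unfolding nondominated_def by blast
    \<comment> \<open>A nondominated vector can be weakly dominated only by an equal one.\<close>
    with \<pi> assms(1) have eq: "criteria p \<sigma> = criteria p \<pi>"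
      unfolding nondominated_def weakly_dominates_iff by blast
    with \<pi> \<sigma>(1) assms(1) have "\<sigma> \<in> nondominated p C"
      unfolding nondominated_def by auto
    with eq show ?thesis by blast
  qed
  have "\<exists>!\<sigma>. \<sigma> \<in> Q \<and> criteria p \<sigma> = criteria p \<pi>"
    if \<pi>: "\<pi> \<in> nondominated p P" for \<pi>
  proof -
    obtain \<sigma> where \<sigma>: "\<sigma> \<in> nondominated p C" "criteria p \<sigma> = criteria p \<pi>"
      using rep[OF \<pi>] by blast
    have "\<exists>!\<tau>. \<tau> \<in> Q \<and> criteria p \<tau> = criteria p \<sigma>"
      using Q \<sigma>(1) by (simp add: is_MinPerm_def)
    then show ?thesis by (simp only: \<sigma>(2))
  qed
  moreover have "Q \<subseteq> nondominated p P"
    using Q sub by (auto simp only: is_MinPerm_def)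
  ultimately show ?thesis
    by (simp add: is_MinPerm_def)
qed

lemma snoc_permutations_of_set:
  "k \<in> S \<Longrightarrow> \<sigma> \<in> permutations_of_set (S - {k}) \<Longrightarrow> \<sigma> @ [k] \<in> permutations_of_set S"
  by (auto simp: permutations_of_set_def)

lemma permutations_of_set_snocE:
  assumes "\<pi> \<in> permutations_of_set S" "S \<noteq> {}"
  obtains \<rho> k where "\<pi> = \<rho> @ [k]" "k \<in> S" "\<rho> \<in> permutations_of_set (S - {k})"
  using assms by (cases \<pi> rule: rev_cases) (auto simp: permutations_of_set_def)

theorem theorem2p2:
  fixes p :: "'j \<Rightarrow> nat \<Rightarrow> nat"
    and S :: "'j set"
    and OptPerm :: "'j set \<Rightarrow> 'j list set"
    and OptPerm_nth :: "nat \<Rightarrow> 'j set \<Rightarrow> 'j list"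
  assumes "finite S" and "S \<noteq> {}"
    and "\<And>k. k \<in> S \<Longrightarrow> is_OptPerm p (S - {k}) (OptPerm (S - {k}))"
    and "\<And>k. k \<in> S \<Longrightarrow>
           bij_betw (\<lambda>l. OptPerm_nth l (S - {k})) {1..card (OptPerm (S - {k}))} (OptPerm (S - {k}))"
  defines "Cand \<equiv> {OptPerm_nth l (S - {k}) @ [k] | k l. k \<in> S \<and> l \<in> {1..card (OptPerm (S - {k}))}}"
  shows "(\<exists>Q. is_MinPerm p Cand Q) \<and> (\<forall>Q. is_MinPerm p Cand Q \<longrightarrow> is_OptPerm p S Q)"
proof -
  \<comment> \<open>The numbering reaches every element of \<open>OptPerm (S - {k})\<close>, so the
    index \<open>l\<close> can be replaced by the permutation itself.\<close>
  have Cand: "Cand = {\<sigma> @ [k] | k \<sigma>. k \<in> S \<and> \<sigma> \<in> OptPerm (S - {k})}"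
  proof -
    have eq: "OptPerm (S - {k}) = (\<lambda>l. OptPerm_nth l (S - {k})) ` {1..card (OptPerm (S - {k}))}"
      if "k \<in> S" for k
      using assms(4)[OF that] by (simp add: bij_betw_def)
    show ?thesis
      unfolding Cand_def using eq by blast
  qed
  have Opt: "is_MinPerm p (permutations_of_set (S - {k})) (OptPerm (S - {k}))" if "k \<in> S" for k
    using assms(3)[OF that] by (simp add: is_OptPerm_def)
  then have sub: "OptPerm (S - {k}) \<subseteq> permutations_of_set (S - {k})" if "k \<in> S" for k
    using that unfolding is_MinPerm_def nondominated_def by blast
  have "Cand \<subseteq> permutations_of_set S"
  proof
    fix \<pi> assume "\<pi> \<in> Cand"
    then obtain \<sigma> k where "\<pi> = \<sigma> @ [k]" "k \<in> S" "\<sigma> \<in> OptPerm (S - {k})"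
      unfolding Cand by blast
    then show "\<pi> \<in> permutations_of_set S"
      using snoc_permutations_of_set[of k S \<sigma>] sub[of k] by auto
  qed
  moreover have "\<exists>\<sigma>\<in>Cand. weakly_dominates (criteria p \<sigma>) (criteria p \<pi>)"
    if "\<pi> \<in> permutations_of_set S" for \<pi>
  proof -
    \<comment> \<open>\<open>k\<close> is the last job of \<open>\<pi>\<close>; the candidate will
      keep it last and change only the prefix \<open>\<rho>\<close>.\<close>
    obtain \<rho> k where \<rho>: "\<pi> = \<rho> @ [k]" "k \<in> S" "\<rho> \<in> permutations_of_set (S - {k})"
      using permutations_of_set_snocE[OF \<open>\<pi> \<in> permutations_of_set S\<close> \<open>S \<noteq> {}\<close>] .
    obtain \<sigma> where \<sigma>: "\<sigma> \<in> OptPerm (S - {k})" "weakly_dominates (criteria p \<sigma>) (criteria p \<rho>)"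
      using is_MinPerm_cover[OF Opt[OF \<rho>(2)] \<rho>(3)] by blast
    \<comment> \<open>Both prefixes are permutations of \<open>S - {k}\<close>, as monotonicity
      under appending requires.\<close>
    have "weakly_dominates (criteria p (\<sigma> @ [k])) (criteria p \<pi>)"
      unfolding \<rho>(1) using criteria_snoc_mono[OF \<rho>(3) _ \<sigma>(2)] sub[OF \<rho>(2)] \<sigma>(1) by auto
    then show ?thesis
      using Cand \<rho>(2) \<sigma>(1) by auto
  qed
  ultimately have "is_OptPerm p S Q" if "is_MinPerm p Cand Q" for Q
    unfolding is_OptPerm_def using that by (rule is_MinPerm_superset)
  then show ?thesis
    using is_MinPerm_exists[of p Cand] by simp
qed

end
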